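(* Let $k\ge 2$. The inverse monoid ${\it Inv}_{k,1}$ and the monoid $M_{k,1}$ are $0$-$J$-simple. The monoid ${\it tot}M_{k,1}$ is $J$-simple.
   Context: Let $k\ge 2$ and $A=\{a_1,\dots,a_k\}$ an alphabet; $A^*$ is the set of all finite words over $A$, with empty word $\varepsilon$. A right ideal of $A^*$ is a set $R\subseteq A^*$ with $RA^*\subseteq R$ (the empty set is allowed). A prefix code is a set $C\subseteq A^*$ in which no element is a prefix of another element. Every right ideal $R$ equals $CA^*$ for a unique prefix code $C$; $R$ is finitely generated iff $C$ is finite. A right ideal homomorphism is a total function $\varphi: R_1\to A^*$, where $R_1={\rm Dom}(\varphi)$ is a right ideal, with $\varphi(xw)=\varphi(x)w$ for all $x\in R_1$, $w\in A^*$; an injective one is called a right ideal isomorphism (onto its image). For right ideals $R'\subseteq R$, $R'$ is essential in $R$ iff $R'$ intersects every non-empty right ideal contained in $R$; a right ideal is called essential iff it is essential in $A^*$. $\varphi$ is an essential extension of $\Phi$ iff ${\rm Dom}(\Phi)$ is contained and essential in ${\rm Dom}(\varphi)$ and $\varphi=\Phi$ on ${\rm Dom}(\Phi)$. Every right ideal homomorphism $\varphi$ with finitely generated domain has a unique maximal essential extension $\max(\varphi)$. $M_{k,1}$ is the monoid of all maximal essential extensions of right ideal homomorphisms between finitely generated right ideals of $A^*$, with multiplication $\varphi\cdot\psi=\max(\varphi\circ\psi)$; its zero element ${\bf 0}$ is the empty map. ${\it tot}M_{k,1}$ is the submonoid of the maximal essential extensions of those homomorphisms whose domain is an essential right ideal;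 ${\it Inv}_{k,1}$ is the submonoid of maximal essential extensions of isomorphisms between finitely generated (not necessarily essential) right ideals. For elements $x,y$ of a monoid $M$: $x\equiv_J y$ iff $x$ and $y$ belong to exactly the same (two-sided) ideals of $M$. $M$ is $J$-simple iff it has only one $J$-class. $M$ is $0$-$J$-simple iff it has exactly two $J$-classes, one of which consists of just a zero element. *)

theory Defs
  imports "HOL-Algebra.Group" "HOL-Library.Cardinality"
begin

text \<open>
  The alphabet is a finite type \<open>'a\<close> with \<open>k = CARD('a)\<close>, so that \<open>'a list\<close> is the set of all
  words. A function with a domain \<open>R \<subseteq> A*\<close> is a map \<open>'a list \<rightharpoonup> 'a list\<close>.
\<close>

definition right_ideal :: "'a list set \<Rightarrow> bool" where
  "right_ideal R \<longleftrightarrow> (\<forall>x\<in>R. \<forall>w. x @ w \<in> R)"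

text \<open>The generating set need not be a prefix code: deleting from a finite \<open>C\<close> every word with a proper
  prefix in \<open>C\<close> leaves the finite prefix code that generates the same right ideal.\<close>

definition fin_gen :: "'a list set \<Rightarrow> bool" where
  "fin_gen R \<longleftrightarrow> (\<exists>C. finite C \<and> R = {c @ w | c w. c \<in> C})"

definition essential_in :: "'a list set \<Rightarrow> 'a list set \<Rightarrow> bool" where
  "essential_in R' R \<longleftrightarrow> right_ideal R' \<and> right_ideal R \<and> R' \<subseteq> R \<and>
     (\<forall>I. right_ideal I \<and> I \<noteq> {} \<and> I \<subseteq> R \<longrightarrow> R' \<inter> I \<noteq> {})"

abbreviation essential :: "'a list set \<Rightarrow> bool" where
  "essential R \<equiv> essential_in R UNIV"

definition ri_hom :: "('a list \<rightharpoonup> 'a list) \<Rightarrow> bool" where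
  "ri_hom f \<longleftrightarrow> right_ideal (dom f) \<and>
     (\<forall>x\<in>dom f. \<forall>w. the (f (x @ w)) = the (f x) @ w)"

definition fg_ri_hom :: "('a list \<rightharpoonup> 'a list) \<Rightarrow> bool" where
  "fg_ri_hom f \<longleftrightarrow> ri_hom f \<and> fin_gen (dom f) \<and> fin_gen (ran f)"

definition ess_ext :: "('a list \<rightharpoonup> 'a list) \<Rightarrow> ('a list \<rightharpoonup> 'a list) \<Rightarrow> bool" where
  "ess_ext f g \<longleftrightarrow> ri_hom f \<and> ri_hom g \<and> essential_in (dom f) (dom g) \<and>
     (\<forall>x\<in>dom f. g x = f x)"

text \<open>Extensions range over all right ideal homomorphisms, with no finiteness condition on the domain.\<close>

definition is_max_ext :: "('a list \<rightharpoonup> 'a list) \<Rightarrow> ('a list \<rightharpoonup> 'a list) \<Rightarrow> bool" where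
  "is_max_ext f g \<longleftrightarrow> ess_ext f g \<and> (\<forall>h. ess_ext f h \<and> g \<subseteq>\<^sub>m h \<longrightarrow> h = g)"

definition max_ext :: "('a list \<rightharpoonup> 'a list) \<Rightarrow> ('a list \<rightharpoonup> 'a list)" where
  "max_ext f = (THE g. is_max_ext f g)"

text \<open>Any two essential extensions of \<open>f\<close> agree where both are defined; their union is the unique
  maximal one, so the description in \<open>max_ext\<close> is proper.\<close>

lemma ri_hom_append:
  assumes "ri_hom f" "f x = Some y"
  shows "f (x @ w) = Some (y @ w)"
proof -
  have "x \<in> dom f" using assms by auto
  hence "x @ w \<in> dom f" "the (f (x @ w)) = the (f x) @ w"
    using assms unfolding ri_hom_def right_ideal_def by blast+
  thus ?thesis using assms by auto
qed

lemma essential_in_meets: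
  assumes "essential_in R' R" "x \<in> R"
  shows "\<exists>w. x @ w \<in> R'"
proof -
  have "right_ideal {x @ w | w. True}"
    unfolding right_ideal_def by force
  moreover have "{x @ w | w. True} \<subseteq> R"
    using assms unfolding essential_in_def right_ideal_def by blast
  ultimately have "R' \<inter> {x @ w | w. True} \<noteq> {}"
    using assms unfolding essential_in_def by blast
  thus ?thesis by blast
qed

lemma ess_ext_agree:
  assumes g: "ess_ext f g" and h: "ess_ext f h" and "g x = Some y" "h x = Some z"
  shows "y = z"
proof -
  obtain w where w: "x @ w \<in> dom f"
    using essential_in_meets[of "dom f" "dom g" x] g assms(3) unfolding ess_ext_def by blast
  have "g (x @ w) = Some (y @ w)" "h (x @ w) = Some (z @ w)"
    using g h assms(3,4) ri_hom_append unfolding ess_ext_def by blast+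
  moreover have "g (x @ w) = f (x @ w)" "h (x @ w) = f (x @ w)"
    using g h w unfolding ess_ext_def by blast+
  ultimately show ?thesis by simp
qed

lemma ex1_max_ext:
  assumes f: "ri_hom f"
  shows "\<exists>!g. is_max_ext f g"
proof -
  define U where "U x = (if \<exists>h y. ess_ext f h \<and> h x = Some y
     then Some (SOME y. \<exists>h. ess_ext f h \<and> h x = Some y) else None)" for x
  have U1: "\<exists>h. ess_ext f h \<and> h x = Some y" if "U x = Some y" for x y
  proof -
    have ex: "\<exists>y h. ess_ext f h \<and> h x = Some y" and y: "y = (SOME y. \<exists>h. ess_ext f h \<and> h x = Some y)"
      using that unfolding U_def by (auto split: if_splits)
    show ?thesis using someI_ex[OF ex] unfolding y .
  qed
  have U2: "U x = Some y" if "ess_ext f h" "h x = Some y" for h x y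
  proof -
    have ex: "\<exists>h y. ess_ext f h \<and> h x = Some y" using that by blast
    then obtain z where z: "U x = Some z" unfolding U_def by simp
    then obtain h' where "ess_ext f h'" "h' x = Some z" using U1 by blast
    thus ?thesis using ess_ext_agree that z by blast
  qed
  have ff: "ess_ext f f" using f unfolding ess_ext_def essential_in_def ri_hom_def by blast
  have app: "U (x @ w) = Some (y @ w)" if xy: "U x = Some y" for x y w
  proof -
    obtain h where h: "ess_ext f h" "h x = Some y" using U1[OF xy] by blast
    hence "h (x @ w) = Some (y @ w)" using ri_hom_append unfolding ess_ext_def by blast
    thus ?thesis using U2 h by blast
  qed
  have hom: "ri_hom U"
    unfolding ri_hom_def right_ideal_def
  proof (intro conjI ballI allI)
    fix x w assume "x \<in> dom U"
    then obtain y where y: "U x = Some y" by blast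
    show "x @ w \<in> dom U" "the (U (x @ w)) = the (U x) @ w"
      using app[OF y, of w] y by auto
  qed
  have meets: "dom f \<inter> I \<noteq> {}" if I: "right_ideal I" "I \<noteq> {}" "I \<subseteq> dom U" for I
  proof -
    obtain x where x: "x \<in> I" using I by blast
    then obtain y where "U x = Some y" using I by blast
    then obtain h where h: "ess_ext f h" "h x = Some y" using U1 by blast
    obtain w where "x @ w \<in> dom f"
      using essential_in_meets[of "dom f" "dom h" x] h unfolding ess_ext_def by blast
    thus ?thesis using I x unfolding right_ideal_def by blast
  qed
  have sub: "\<forall>x\<in>dom f. U x = f x" using U2[OF ff] by auto
  have "ess_ext f U"
    unfolding ess_ext_def essential_in_def using f hom sub meets
    unfolding ri_hom_def by (metis domIff subsetI)
  moreover have le: "h \<subseteq>\<^sub>m U" if "ess_ext f h" for h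
    using U2[OF that] unfolding map_le_def by auto
  ultimately have "is_max_ext f U"
    unfolding is_max_ext_def using map_le_antisym by blast
  moreover have "g = U" if "is_max_ext f g" for g
    using that le \<open>ess_ext f U\<close> unfolding is_max_ext_def by blast
  ultimately show ?thesis by blast
qed

text \<open>\<open>f \<circ>\<^sub>m g\<close> applies \<open>g\<close> first. The identity on all words is \<open>Some\<close>, and the zero is \<open>Map.empty\<close>.\<close>

definition M_k1 :: "('a::finite list \<rightharpoonup> 'a list) monoid" where
  "M_k1 = \<lparr>carrier = {max_ext f | f. fg_ri_hom f},
           monoid.mult = (\<lambda>f g. max_ext (f \<circ>\<^sub>m g)),
           one = Some\<rparr>"

definition tot_M_k1 :: "('a::finite list \<rightharpoonup> 'a list) monoid" where
  "tot_M_k1 = M_k1\<lparr>carrier := {max_ext f | f. fg_ri_hom f \<and> essential (dom f)}\<rparr>"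

definition Inv_k1 :: "('a::finite list \<rightharpoonup> 'a list) monoid" where
  "Inv_k1 = M_k1\<lparr>carrier := {max_ext f | f. fg_ri_hom f \<and> inj_on f (dom f)}\<rparr>"

definition monoid_ideal :: "('m, 'r) monoid_scheme \<Rightarrow> 'm set \<Rightarrow> bool" where
  "monoid_ideal M I \<longleftrightarrow> I \<subseteq> carrier M \<and>
     (\<forall>x\<in>I. \<forall>m\<in>carrier M. m \<otimes>\<^bsub>M\<^esub> x \<in> I \<and> x \<otimes>\<^bsub>M\<^esub> m \<in> I)"

definition J_rel :: "('m, 'r) monoid_scheme \<Rightarrow> 'm rel" where
  "J_rel M = {(x, y). x \<in> carrier M \<and> y \<in> carrier M \<and>
     (\<forall>I. monoid_ideal M I \<longrightarrow> (x \<in> I \<longleftrightarrow> y \<in> I))}"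

definition J_classes :: "('m, 'r) monoid_scheme \<Rightarrow> 'm set set" where
  "J_classes M = carrier M // J_rel M"

definition is_zero :: "('m, 'r) monoid_scheme \<Rightarrow> 'm \<Rightarrow> bool" where
  "is_zero M z \<longleftrightarrow> z \<in> carrier M \<and>
     (\<forall>m\<in>carrier M. m \<otimes>\<^bsub>M\<^esub> z = z \<and> z \<otimes>\<^bsub>M\<^esub> m = z)"

text \<open>Both notions are properties of monoids, so they include the monoid axioms.\<close>

definition J_simple :: "('m, 'r) monoid_scheme \<Rightarrow> bool" where
  "J_simple M \<longleftrightarrow> monoid M \<and> card (J_classes M) = 1"

definition zero_J_simple :: "('m, 'r) monoid_scheme \<Rightarrow> bool" where
  "zero_J_simple M \<longleftrightarrow> monoid M \<and> card (J_classes M) = 2 \<and>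
     (\<exists>z. is_zero M z \<and> {z} \<in> J_classes M)"

end

theory Submission
  imports Defs
begin

text \<open>
  The three monoids differ only in the class of homomorphisms whose maximal essential extensions
  they contain, and the proof is the same for each. Two ideas carry it.

  Maximal extension is compatible with composition: an essential extension of each factor gives an
  essential extension of the composite (\<open>ess_ext_comp\<close>), and two homomorphisms of which one
  essentially extends the other have the same maximal extension (\<open>max_ext_eq\<close>). Hence products can
  be computed on any representatives, \<open>max f \<cdot> max g = max (f \<circ> g)\<close> (\<open>max_ext_comp\<close>). So every class
  of homomorphisms that contains the identity and is closed under composition yields a monoid
  (\<open>monoid_max_monoid\<close>); for the three classes at hand, the main point of closure is that
  finite generation survives composition (\<open>fg_ri_hom_comp\<close>).

  A non-empty homomorphism \<open>f\<close> maps some word \<open>x\<close> to a word \<open>y\<close>, hence \<open>x w\<close> to \<open>y w\<close> for every \<open>w\<close>.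
  Composing with \<open>w \<mapsto> x w\<close> on the right and with the removal of the prefix \<open>y\<close> on the left gives the
  identity, so each ideal that contains \<open>max f\<close> contains \<open>1\<close> and is the whole monoid. Both outer
  factors are isomorphisms between finitely generated right ideals, which settles the two monoids
  with zero: there the empty map alone forms an ideal, and all other elements generate the whole
  monoid. The domain of the left factor, the words with prefix \<open>y\<close>, need not be essential; for
  the totally defined elements it is replaced by the map that deletes the first \<open>|y|\<close> letters of
  every word that has as many.
\<close>

section \<open>Homomorphisms and essential extensions\<close>

lemma ri_hom_iff: "ri_hom f \<longleftrightarrow> (\<forall>x y w. f x = Some y \<longrightarrow> f (x @ w) = Some (y @ w))"
proof
  assume "ri_hom f"
  thus "\<forall>x y w. f x = Some y \<longrightarrow> f (x @ w) = Some (y @ w)"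
    using ri_hom_append by blast
next
  assume *: "\<forall>x y w. f x = Some y \<longrightarrow> f (x @ w) = Some (y @ w)"
  show "ri_hom f"
    unfolding ri_hom_def right_ideal_def
  proof (intro conjI ballI allI)
    fix x w assume "x \<in> dom f"
    then obtain y where y: "f x = Some y" by blast
    show "x @ w \<in> dom f" "the (f (x @ w)) = the (f x) @ w"
      using *[rule_format, OF y, of w] y by auto
  qed
qed

lemma right_ideal_dom: "ri_hom f \<Longrightarrow> right_ideal (dom f)"
  unfolding ri_hom_def by blast

text \<open>It suffices to test essentiality on the principal right ideals.\<close>

lemma essential_in_iff:
  "essential_in R' R \<longleftrightarrow>
     right_ideal R' \<and> right_ideal R \<and> R' \<subseteq> R \<and> (\<forall>x\<in>R. \<exists>w. x @ w \<in> R')"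
  (is "_ \<longleftrightarrow> ?rhs")
proof
  assume "essential_in R' R"
  thus ?rhs using essential_in_meets unfolding essential_in_def by blast
next
  assume r: ?rhs
  have "R' \<inter> I \<noteq> {}" if I: "right_ideal I" "I \<noteq> {}" "I \<subseteq> R" for I
  proof -
    obtain x where x: "x \<in> I" using I by blast
    then obtain w where "x @ w \<in> R'" using r I by blast
    moreover have "x @ w \<in> I" using I x unfolding right_ideal_def by blast
    ultimately show ?thesis by blast
  qed
  thus "essential_in R' R" using r unfolding essential_in_def by blast
qed

lemma essential_iff: "essential R \<longleftrightarrow> right_ideal R \<and> (\<forall>x. \<exists>w. x @ w \<in> R)"
  unfolding essential_in_iff by (auto simp: right_ideal_def)

lemma ess_ext_iff:
  "ess_ext f g \<longleftrightarrow> ri_hom f \<and> ri_hom g \<and> f \<subseteq>\<^sub>m g \<and> (\<forall>x\<in>dom g. \<exists>w. x @ w \<in> dom f)"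
proof -
  have "dom f \<subseteq> dom g" if "f \<subseteq>\<^sub>m g"
    using that by (rule map_le_implies_dom_le)
  thus ?thesis
    unfolding ess_ext_def essential_in_iff map_le_def
    using right_ideal_dom[of f] right_ideal_dom[of g] by metis
qed

lemma ess_ext_refl: "ri_hom f \<Longrightarrow> ess_ext f f"
  unfolding ess_ext_iff by (metis append_Nil2 map_le_refl)

lemma ess_ext_trans:
  assumes fg: "ess_ext f g" and gh: "ess_ext g h"
  shows "ess_ext f h"
  unfolding ess_ext_iff
proof (intro conjI ballI)
  show "ri_hom f" "ri_hom h" using fg gh unfolding ess_ext_iff by blast+
  show "f \<subseteq>\<^sub>m h" using fg gh map_le_trans unfolding ess_ext_iff by blast
  fix x assume "x \<in> dom h"
  then obtain v where "x @ v \<in> dom g" using gh unfolding ess_ext_iff by blast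
  then obtain w where "(x @ v) @ w \<in> dom f" using fg unfolding ess_ext_iff by blast
  thus "\<exists>w. x @ w \<in> dom f" by (metis append_assoc)
qed

lemma is_max_ext_max_ext: "ri_hom f \<Longrightarrow> is_max_ext f (max_ext f)"
  unfolding max_ext_def by (rule theI'[OF ex1_max_ext])

lemma ess_ext_max_ext: "ri_hom f \<Longrightarrow> ess_ext f (max_ext f)"
  using is_max_ext_max_ext unfolding is_max_ext_def by blast

lemma max_ext_unique: "is_max_ext f g \<Longrightarrow> max_ext f = g"
  using ex1_max_ext[of f] is_max_ext_max_ext[of f]
  unfolding is_max_ext_def ess_ext_def by blast

text \<open>
  The essential extensions of \<open>f\<close> that lie above \<open>g\<close> are exactly the essential extensions of \<open>g\<close>,
  because a domain stays essential when it grows from \<open>dom f\<close> to \<open>dom g\<close>.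
\<close>

lemma max_ext_eq:
  assumes fg: "ess_ext f g"
  shows "max_ext f = max_ext g"
proof (rule max_ext_unique)
  have g: "ri_hom g" using fg unfolding ess_ext_iff by blast
  let ?h = "max_ext g"
  have gh: "ess_ext g ?h" and max: "\<And>h'. ess_ext g h' \<Longrightarrow> ?h \<subseteq>\<^sub>m h' \<Longrightarrow> h' = ?h"
    using is_max_ext_max_ext[OF g] unfolding is_max_ext_def by blast+
  have "h' = ?h" if h': "ess_ext f h'" "?h \<subseteq>\<^sub>m h'" for h'
  proof (rule max)
    have gh': "g \<subseteq>\<^sub>m h'" using gh h' map_le_trans unfolding ess_ext_iff by blast
    have "dom f \<subseteq> dom g" using fg unfolding ess_ext_def essential_in_def by blast
    thus "ess_ext g h'" using g gh' h' unfolding ess_ext_iff by blast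
    show "?h \<subseteq>\<^sub>m h'" by fact
  qed
  thus "is_max_ext f ?h"
    using ess_ext_trans[OF fg gh] unfolding is_max_ext_def by blast
qed

lemma ri_hom_Some: "ri_hom Some"
  unfolding ri_hom_iff by simp

lemma ri_hom_empty: "ri_hom Map.empty"
  unfolding ri_hom_iff by simp

lemma max_ext_Some: "max_ext Some = Some"
  using ess_ext_max_ext[OF ri_hom_Some] unfolding ess_ext_def by auto

lemma max_ext_empty: "max_ext Map.empty = Map.empty"
  using ess_ext_max_ext[OF ri_hom_empty] unfolding ess_ext_iff by auto

section \<open>Composition\<close>

lemma map_comp_assoc: "(f \<circ>\<^sub>m g) \<circ>\<^sub>m h = f \<circ>\<^sub>m (g \<circ>\<^sub>m h)"
  by (auto simp: map_comp_def fun_eq_iff split: option.split)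

lemma map_comp_Some_id: "f \<circ>\<^sub>m Some = f" "Some \<circ>\<^sub>m f = f"
  by (auto simp: map_comp_def fun_eq_iff split: option.split)

lemma ri_hom_comp: "ri_hom f \<Longrightarrow> ri_hom g \<Longrightarrow> ri_hom (f \<circ>\<^sub>m g)"
  unfolding ri_hom_iff map_comp_Some_iff by blast

text \<open>
  A word \<open>x\<close> in the domain of \<open>F \<circ> G\<close> is prolonged twice: first until \<open>g\<close> is defined on it, and then
  until the image lies in the domain of \<open>f\<close>.
\<close>

lemma ess_ext_comp:
  assumes f: "ess_ext f F" and g: "ess_ext g G"
  shows "ess_ext (f \<circ>\<^sub>m g) (F \<circ>\<^sub>m G)"
  unfolding ess_ext_iff
proof (intro conjI ballI)
  note f' = f[unfolded ess_ext_iff] and g' = g[unfolded ess_ext_iff]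
  have leD: "M a = Some b" if "m \<subseteq>\<^sub>m M" "m a = Some b"
    for m M :: "'a list \<rightharpoonup> 'a list" and a b
    using that unfolding map_le_def by (metis domI)
  show "ri_hom (f \<circ>\<^sub>m g)" "ri_hom (F \<circ>\<^sub>m G)"
    using f' g' ri_hom_comp by blast+
  show "f \<circ>\<^sub>m g \<subseteq>\<^sub>m F \<circ>\<^sub>m G"
    unfolding map_le_def
  proof
    fix a assume "a \<in> dom (f \<circ>\<^sub>m g)"
    then obtain b c where "g a = Some b" "f b = Some c"
      by (auto simp: map_comp_Some_iff)
    moreover from this have "G a = Some b" "F b = Some c"
      using f' g' leD by blast+
    ultimately show "(f \<circ>\<^sub>m g) a = (F \<circ>\<^sub>m G) a" by simp
  qed
  fix x assume "x \<in> dom (F \<circ>\<^sub>m G)"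
  then obtain y z where y: "G x = Some y" and z: "F y = Some z"
    by (auto simp: map_comp_Some_iff)
  obtain v where v: "x @ v \<in> dom g" using g' y by blast
  have "G (x @ v) = Some (y @ v)" using g' y ri_hom_append by blast
  hence gv: "g (x @ v) = Some (y @ v)" using g v unfolding ess_ext_def by auto
  have "y @ v \<in> dom F" using f' z ri_hom_append by blast
  then obtain w where w: "(y @ v) @ w \<in> dom f" using f' by blast
  have "g ((x @ v) @ w) = Some ((y @ v) @ w)" using g' gv ri_hom_append by blast
  hence "x @ (v @ w) \<in> dom (f \<circ>\<^sub>m g)" using w by (auto simp: map_comp_def)
  thus "\<exists>w. x @ w \<in> dom (f \<circ>\<^sub>m g)" by blast
qed

lemma max_ext_comp:
  assumes "ri_hom f" "ri_hom g"
  shows "max_ext (max_ext f \<circ>\<^sub>m max_ext g) = max_ext (f \<circ>\<^sub>m g)"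
  using max_ext_eq[OF ess_ext_comp[OF assms[THEN ess_ext_max_ext]]] by simp

section \<open>Finite generation\<close>

text \<open>
  Generators have bounded length, so each word of the ideal has a prefix of bounded length there. Conversely, a finite alphabet has only finitely many words up to a given length, and those
  in the ideal can serve as generators. Inverse images under homomorphisms are easier to treat with
  this bound than with generating sets.
\<close>

lemma fin_gen_iff:
  fixes R :: "'a::finite list set"
  shows "fin_gen R \<longleftrightarrow> right_ideal R \<and> (\<exists>n. \<forall>x\<in>R. take n x \<in> R)"
proof
  assume "fin_gen R"
  then obtain C where C: "finite C" and R: "R = {c @ w | c w. c \<in> C}"
    unfolding fin_gen_def by blast
  obtain n where n: "\<forall>c\<in>C. length c \<le> n"
    using finite_nat_set_iff_bounded_le[of "length ` C"] C by auto
  have "take n x \<in> R" if x: "x \<in> R" for x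
  proof -
    obtain c w where cw: "c \<in> C" "x = c @ w" using x R by blast
    hence "take n x = c @ take (n - length c) w" using n by simp
    thus ?thesis using R cw by blast
  qed
  moreover have "right_ideal R"
    unfolding right_ideal_def R by force
  ultimately show "right_ideal R \<and> (\<exists>n. \<forall>x\<in>R. take n x \<in> R)" by blast
next
  assume "right_ideal R \<and> (\<exists>n. \<forall>x\<in>R. take n x \<in> R)"
  then obtain n where R: "right_ideal R" and n: "\<forall>x\<in>R. take n x \<in> R" by blast
  let ?C = "{x \<in> R. length x \<le> n}"
  have "finite ?C"
    using finite_lists_length_le[of "UNIV :: 'a set" n] by (rule rev_finite_subset) auto
  moreover have "R = {c @ w | c w. c \<in> ?C}"
  proof (intro equalityI subsetI)
    fix x assume "x \<in> R"
    hence "take n x \<in> ?C" using n by simp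
    thus "x \<in> {c @ w | c w. c \<in> ?C}"
      by (metis (mono_tags, lifting) append_take_drop_id mem_Collect_eq)
  next
    fix x assume "x \<in> {c @ w | c w. c \<in> ?C}"
    thus "x \<in> R" using R unfolding right_ideal_def by blast
  qed
  ultimately show "fin_gen R" unfolding fin_gen_def by blast
qed

lemma right_ideal_ran:
  assumes "ri_hom f"
  shows "right_ideal (ran f)"
  using assms unfolding right_ideal_def ri_hom_iff ran_def by blast

text \<open>
  If \<open>dom f\<close> is detected on prefixes of length \<open>n\<close>, then each value of \<open>f\<close> prolongs the value of some
  word of length at most \<open>n\<close>. There are finitely many such words, which bounds the generators of the
  range.
\<close>

lemma fin_gen_ran:
  fixes f :: "'a::finite list \<rightharpoonup> 'a list"
  assumes f: "ri_hom f" and dom: "fin_gen (dom f)"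
  shows "fin_gen (ran f)"
proof -
  obtain n where n: "\<forall>x\<in>dom f. take n x \<in> dom f" using dom unfolding fin_gen_iff by blast
  have "finite {c :: 'a list. length c \<le> n}"
    using finite_lists_length_le[of "UNIV :: 'a set" n] by simp
  then obtain b where b: "\<And>c :: 'a list. length c \<le> n \<Longrightarrow> length (the (f c)) \<le> b"
    using finite_nat_set_iff_bounded_le[of "(\<lambda>c. length (the (f c))) ` {c. length c \<le> n}"]
    by auto
  have "take b y \<in> ran f" if y: "y \<in> ran f" for y
  proof -
    obtain x where x: "f x = Some y" using y unfolding ran_def by blast
    then obtain z where z: "f (take n x) = Some z" using n by blast
    have "f (take n x @ drop n x) = Some (z @ drop n x)" using ri_hom_append[OF f z] .
    hence y_eq: "y = z @ drop n x" using x by simp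
    have "length z \<le> b" using b[of "take n x"] z by simp
    hence "take b y = z @ take (b - length z) (drop n x)" using y_eq by simp
    moreover have "z \<in> ran f" using z by (auto simp: ran_def)
    ultimately show ?thesis
      using right_ideal_ran[OF f] unfolding right_ideal_def by metis
  qed
  thus ?thesis using right_ideal_ran[OF f] unfolding fin_gen_iff by blast
qed

lemma fg_ri_hom_iff:
  fixes f :: "'a::finite list \<rightharpoonup> 'a list"
  shows "fg_ri_hom f \<longleftrightarrow> ri_hom f \<and> (\<exists>n. \<forall>x\<in>dom f. take n x \<in> dom f)"
  unfolding fg_ri_hom_def using fin_gen_ran fin_gen_iff right_ideal_dom by blast

lemma fg_ri_hom_comp:
  fixes f g :: "'a::finite list \<rightharpoonup> 'a list"
  assumes "fg_ri_hom f" "fg_ri_hom g"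
  shows "fg_ri_hom (f \<circ>\<^sub>m g)"
proof -
  have f: "ri_hom f" and g: "ri_hom g" using assms unfolding fg_ri_hom_def by blast+
  obtain m where m: "\<forall>x\<in>dom f. take m x \<in> dom f"
    using assms unfolding fg_ri_hom_iff by blast
  obtain n where n: "\<forall>x\<in>dom g. take n x \<in> dom g"
    using assms unfolding fg_ri_hom_iff by blast
  \<comment> \<open>Beyond the \<open>n\<close> letters on which \<open>g\<close> acts, \<open>m\<close> further letters are copied, so the image of a
    prefix of length \<open>n + m\<close> contains the first \<open>m\<close> letters of the image of the word.\<close>
  have "take (n + m) x \<in> dom (f \<circ>\<^sub>m g)" if x: "x \<in> dom (f \<circ>\<^sub>m g)" for x
  proof -
    obtain y where y: "g x = Some y" and fy: "y \<in> dom f"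
      using x unfolding dom_def mem_Collect_eq by (auto simp: map_comp_Some_iff)
    obtain z where z: "g (take n x) = Some z" using n y by blast
    have gz: "g (take n x @ w) = Some (z @ w)" for w using ri_hom_append[OF g z] .
    have yz: "y = z @ drop n x" using gz[of "drop n x"] y by simp
    have "take m y = take m (z @ take m (drop n x))" by (simp add: yz)
    hence "z @ take m (drop n x) = take m y @ drop m (z @ take m (drop n x))"
      by (simp only: append_take_drop_id)
    moreover have "take m y \<in> dom f" using m fy by blast
    ultimately have "z @ take m (drop n x) \<in> dom f"
      using right_ideal_dom[OF f] unfolding right_ideal_def by metis
    moreover have "g (take (n + m) x) = Some (z @ take m (drop n x))"
      using gz by (simp add: take_add)
    ultimately show ?thesis by (auto simp: map_comp_def)
  qed
  thus ?thesis using ri_hom_comp[OF f g] unfolding fg_ri_hom_iff by blast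
qed

section \<open>The monoid given by a class of homomorphisms\<close>

definition max_monoid :: "(('a::finite list \<rightharpoonup> 'a list) \<Rightarrow> bool) \<Rightarrow> ('a list \<rightharpoonup> 'a list) monoid" where
  "max_monoid P = M_k1\<lparr>carrier := {max_ext f | f. P f}\<rparr>"

lemma max_monoid_simps [simp]:
  "carrier (max_monoid P) = {max_ext f | f. P f}"
  "x \<otimes>\<^bsub>max_monoid P\<^esub> y = max_ext (x \<circ>\<^sub>m y)"
  "\<one>\<^bsub>max_monoid P\<^esub> = Some"
  by (simp_all add: max_monoid_def M_k1_def)

definition composition_closed :: "(('a list \<rightharpoonup> 'a list) \<Rightarrow> bool) \<Rightarrow> bool" where
  "composition_closed P \<longleftrightarrow>
     (\<forall>f. P f \<longrightarrow> ri_hom f) \<and> P Some \<and> (\<forall>f g. P f \<longrightarrow> P g \<longrightarrow> P (f \<circ>\<^sub>m g))"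

lemma composition_closedD:
  assumes "composition_closed P"
  shows "P f \<Longrightarrow> ri_hom f" "P Some" "P f \<Longrightarrow> P g \<Longrightarrow> P (f \<circ>\<^sub>m g)"
  using assms unfolding composition_closed_def by blast+

lemma composition_closed_conj:
  assumes "composition_closed P" and "Q Some"
    and "\<And>f g. P f \<Longrightarrow> P g \<Longrightarrow> Q f \<Longrightarrow> Q g \<Longrightarrow> Q (f \<circ>\<^sub>m g)"
  shows "composition_closed (\<lambda>f. P f \<and> Q f)"
  using assms unfolding composition_closed_def by simp

lemma monoid_max_monoid:
  assumes P: "composition_closed P"
  shows "monoid (max_monoid P)"
proof
  note D = composition_closedD[OF P]
  have comp: "max_ext (max_ext f \<circ>\<^sub>m max_ext g) = max_ext (f \<circ>\<^sub>m g)" if "P f" "P g" for f g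
    using that D max_ext_comp by blast
  have one: "Some = max_ext Some" by (simp add: max_ext_Some)
  show "\<one>\<^bsub>max_monoid P\<^esub> \<in> carrier (max_monoid P)"
    using D(2) one by auto
  fix x y z
  assume "x \<in> carrier (max_monoid P)"
  then obtain f where f: "P f" "x = max_ext f" by auto
  show "\<one>\<^bsub>max_monoid P\<^esub> \<otimes>\<^bsub>max_monoid P\<^esub> x = x"
    using comp[OF D(2) f(1)] f by (simp add: max_ext_Some map_comp_Some_id)
  show "x \<otimes>\<^bsub>max_monoid P\<^esub> \<one>\<^bsub>max_monoid P\<^esub> = x"
    using comp[OF f(1) D(2)] f by (simp add: max_ext_Some map_comp_Some_id)
  assume "y \<in> carrier (max_monoid P)"
  then obtain g where g: "P g" "y = max_ext g" by auto
  show "x \<otimes>\<^bsub>max_monoid P\<^esub> y \<in> carrier (max_monoid P)"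
    using f g comp[OF f(1) g(1)] D(3)[OF f(1) g(1)] by auto
  assume "z \<in> carrier (max_monoid P)"
  then obtain h where h: "P h" "z = max_ext h" by auto
  show "x \<otimes>\<^bsub>max_monoid P\<^esub> y \<otimes>\<^bsub>max_monoid P\<^esub> z = x \<otimes>\<^bsub>max_monoid P\<^esub> (y \<otimes>\<^bsub>max_monoid P\<^esub> z)"
    using f g h by (simp add: comp D(3) map_comp_assoc)
qed

text \<open>
  If \<open>f x = y\<close>, then inserting the prefix \<open>x\<close>, applying \<open>f\<close> and removing the prefix \<open>y\<close> fixes every
  word. A map that removes \<open>y\<close> may act in any way on words without this prefix; this freedom is
  what allows its domain to be essential when the class demands it.
\<close>

lemma one_eq_product:
  assumes P: "composition_closed P"
    and ins: "\<And>x. P (\<lambda>w. Some (x @ w))"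
    and del: "\<And>y. \<exists>p. P p \<and> (\<forall>w. p (y @ w) = Some w)"
    and F: "F \<in> carrier (max_monoid P)" "F \<noteq> Map.empty"
  shows "\<exists>p\<in>carrier (max_monoid P). \<exists>q\<in>carrier (max_monoid P).
           p \<otimes>\<^bsub>max_monoid P\<^esub> F \<otimes>\<^bsub>max_monoid P\<^esub> q = \<one>\<^bsub>max_monoid P\<^esub>"
proof -
  note D = composition_closedD[OF P]
  obtain f where f: "P f" "F = max_ext f" using F by auto
  have "f \<noteq> Map.empty" using F f max_ext_empty by auto
  then obtain x y where xy: "f x = Some y" by fastforce
  obtain p where p: "P p" "\<And>w. p (y @ w) = Some w" using del by blast
  let ?q = "\<lambda>w. Some (x @ w)"
  have "p \<circ>\<^sub>m f \<circ>\<^sub>m ?q = Some"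
    using ri_hom_append[OF D(1)[OF f(1)] xy] p by (auto simp: map_comp_def)
  moreover have "max_ext (max_ext (max_ext p \<circ>\<^sub>m F) \<circ>\<^sub>m max_ext ?q) = max_ext (p \<circ>\<^sub>m f \<circ>\<^sub>m ?q)"
    using f p ins D by (simp add: max_ext_comp)
  ultimately have "max_ext p \<otimes>\<^bsub>max_monoid P\<^esub> F \<otimes>\<^bsub>max_monoid P\<^esub> max_ext ?q = \<one>\<^bsub>max_monoid P\<^esub>"
    by (simp add: max_ext_Some)
  moreover have "max_ext p \<in> carrier (max_monoid P)" "max_ext ?q \<in> carrier (max_monoid P)"
    using p ins by auto
  ultimately show ?thesis by blast
qed

lemma is_zero_max_monoid:
  assumes "P Map.empty"
  shows "is_zero (max_monoid P) Map.empty"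
proof -
  have "Map.empty \<circ>\<^sub>m m = Map.empty" for m :: "'a list \<rightharpoonup> 'a list"
    by (auto simp: map_comp_def fun_eq_iff split: option.split)
  moreover have "Map.empty \<in> carrier (max_monoid P)"
    by (simp, rule exI[of _ Map.empty]) (simp add: assms max_ext_empty)
  ultimately show ?thesis
    unfolding is_zero_def by (simp add: max_ext_empty)
qed

section \<open>Ideals and J-classes\<close>

lemma monoid_ideal_eq_carrier:
  assumes M: "monoid M" and I: "monoid_ideal M I" and x: "x \<in> I"
    and pq: "p \<in> carrier M" "q \<in> carrier M" "p \<otimes>\<^bsub>M\<^esub> x \<otimes>\<^bsub>M\<^esub> q = \<one>\<^bsub>M\<^esub>"
  shows "I = carrier M"
proof -
  have "p \<otimes>\<^bsub>M\<^esub> x \<otimes>\<^bsub>M\<^esub> q \<in> I" using I x pq unfolding monoid_ideal_def by blast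
  hence "\<one>\<^bsub>M\<^esub> \<in> I" by (simp add: pq(3))
  hence "\<one>\<^bsub>M\<^esub> \<otimes>\<^bsub>M\<^esub> m \<in> I" if "m \<in> carrier M" for m
    using I that unfolding monoid_ideal_def by blast
  hence "m \<in> I" if "m \<in> carrier M" for m
    using that monoid.l_one[OF M] by metis
  thus ?thesis using I unfolding monoid_ideal_def by blast
qed

lemma J_rel_if_factors_one:
  assumes M: "monoid M" and xy: "x \<in> carrier M" "y \<in> carrier M"
    and "\<exists>p\<in>carrier M. \<exists>q\<in>carrier M. p \<otimes>\<^bsub>M\<^esub> x \<otimes>\<^bsub>M\<^esub> q = \<one>\<^bsub>M\<^esub>"
    and "\<exists>p\<in>carrier M. \<exists>q\<in>carrier M. p \<otimes>\<^bsub>M\<^esub> y \<otimes>\<^bsub>M\<^esub> q = \<one>\<^bsub>M\<^esub>"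
  shows "(x, y) \<in> J_rel M"
proof -
  have "x \<in> I \<longleftrightarrow> y \<in> I" if I: "monoid_ideal M I" for I
    using monoid_ideal_eq_carrier[OF M I] assms(2-) by metis
  thus ?thesis using xy unfolding J_rel_def by blast
qed

lemma J_simpleI:
  assumes M: "monoid M"
    and one: "\<And>x. x \<in> carrier M \<Longrightarrow>
      \<exists>p\<in>carrier M. \<exists>q\<in>carrier M. p \<otimes>\<^bsub>M\<^esub> x \<otimes>\<^bsub>M\<^esub> q = \<one>\<^bsub>M\<^esub>"
  shows "J_simple M"
proof -
  have "J_rel M `` {x} = carrier M" if "x \<in> carrier M" for x
    using J_rel_if_factors_one[OF M that _ one[OF that] one] unfolding J_rel_def by blast
  moreover have "\<one>\<^bsub>M\<^esub> \<in> carrier M" using monoid.one_closed[OF M] .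
  ultimately have "J_classes M = {carrier M}"
    unfolding J_classes_def quotient_def by auto
  thus ?thesis using M unfolding J_simple_def by simp
qed

text \<open>The ideal \<open>{z}\<close> separates \<open>z\<close> from all other elements, and no ideal separates two of those.\<close>

lemma zero_J_simpleI:
  assumes M: "monoid M" and z: "is_zero M z" and "\<one>\<^bsub>M\<^esub> \<noteq> z"
    and one: "\<And>x. x \<in> carrier M \<Longrightarrow> x \<noteq> z \<Longrightarrow>
      \<exists>p\<in>carrier M. \<exists>q\<in>carrier M. p \<otimes>\<^bsub>M\<^esub> x \<otimes>\<^bsub>M\<^esub> q = \<one>\<^bsub>M\<^esub>"
  shows "zero_J_simple M"
proof -
  have zc: "z \<in> carrier M" using z unfolding is_zero_def by blast
  have 1: "\<one>\<^bsub>M\<^esub> \<in> carrier M" using monoid.one_closed[OF M] .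
  have ideal: "monoid_ideal M {z}"
    using z unfolding monoid_ideal_def is_zero_def by blast
  have cz: "J_rel M `` {z} = {z}"
    using zc ideal unfolding J_rel_def by blast
  have cx: "J_rel M `` {x} = carrier M - {z}" if x: "x \<in> carrier M" "x \<noteq> z" for x
  proof (intro equalityI subsetI)
    fix y assume "y \<in> J_rel M `` {x}"
    thus "y \<in> carrier M - {z}" using x ideal unfolding J_rel_def by blast
  next
    fix y assume "y \<in> carrier M - {z}"
    thus "y \<in> J_rel M `` {x}"
      using J_rel_if_factors_one[OF M x(1) _ one[OF x] one] by blast
  qed
  have "J_classes M = (\<lambda>x. J_rel M `` {x}) ` carrier M"
    unfolding J_classes_def quotient_def by blast
  also have "\<dots> = {{z}, carrier M - {z}}"
  proof (intro equalityI subsetI)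
    fix C assume "C \<in> (\<lambda>x. J_rel M `` {x}) ` carrier M"
    thus "C \<in> {{z}, carrier M - {z}}" using cz cx by blast
  next
    fix C assume "C \<in> {{z}, carrier M - {z}}"
    hence "C = J_rel M `` {z} \<or> C = J_rel M `` {\<one>\<^bsub>M\<^esub>}"
      using cz cx[OF 1 assms(3)] by simp
    thus "C \<in> (\<lambda>x. J_rel M `` {x}) ` carrier M" using zc 1 by blast
  qed
  finally have classes: "J_classes M = {{z}, carrier M - {z}}" .
  moreover have "{z} \<noteq> carrier M - {z}" by blast
  ultimately have "card (J_classes M) = 2" by simp
  thus ?thesis using M z classes unfolding zero_J_simple_def by blast
qed

lemma zero_J_simple_max_monoid:
  assumes P: "composition_closed P" and "P Map.empty"
    and "\<And>x. P (\<lambda>w. Some (x @ w))"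
    and "\<And>y. \<exists>p. P p \<and> (\<forall>w. p (y @ w) = Some w)"
  shows "zero_J_simple (max_monoid P)"
proof (rule zero_J_simpleI)
  show "monoid (max_monoid P)" using monoid_max_monoid[OF P] .
  show "is_zero (max_monoid P) Map.empty" using is_zero_max_monoid assms(2) .
  show "\<one>\<^bsub>max_monoid P\<^esub> \<noteq> Map.empty" by (simp add: fun_eq_iff)
qed (rule one_eq_product[OF P assms(3,4)])

section \<open>The three classes\<close>

lemma fg_ri_hom_Some: "fg_ri_hom (Some :: 'a::finite list \<rightharpoonup> 'a list)"
  unfolding fg_ri_hom_iff using ri_hom_Some by auto

lemma fg_ri_hom_empty: "fg_ri_hom (Map.empty :: 'a::finite list \<rightharpoonup> 'a list)"
  unfolding fg_ri_hom_iff using ri_hom_empty by auto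

lemma fg_ri_hom_insert: "fg_ri_hom (\<lambda>w :: 'a::finite list. Some (x @ w))"
  unfolding fg_ri_hom_iff ri_hom_iff by auto

definition remove_prefix :: "'a list \<Rightarrow> 'a list \<rightharpoonup> 'a list" where
  "remove_prefix y u = (if take (length y) u = y then Some (drop (length y) u) else None)"

lemma remove_prefix_eq_Some_iff: "remove_prefix y u = Some v \<longleftrightarrow> u = y @ v"
proof -
  have "u = y @ drop (length y) u" if "take (length y) u = y"
    using that by (metis append_take_drop_id)
  thus ?thesis unfolding remove_prefix_def by auto
qed

lemma dom_remove_prefix: "dom (remove_prefix y) = range ((@) y)"
  by (auto simp: remove_prefix_eq_Some_iff)

lemma fg_ri_hom_remove_prefix: "fg_ri_hom (remove_prefix (y :: 'a::finite list))"
proof -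
  have "\<forall>x\<in>dom (remove_prefix y). take (length y) x \<in> dom (remove_prefix y)"
    unfolding dom_remove_prefix by (auto intro: range_eqI[where x = "[]"])
  thus ?thesis unfolding fg_ri_hom_iff ri_hom_iff remove_prefix_eq_Some_iff by auto
qed

lemma inj_on_remove_prefix: "inj_on (remove_prefix y) (dom (remove_prefix y))"
  by (auto simp: inj_on_def) (metis remove_prefix_eq_Some_iff)

definition drop_letters :: "nat \<Rightarrow> 'a list \<rightharpoonup> 'a list" where
  "drop_letters n u = (if n \<le> length u then Some (drop n u) else None)"

lemma dom_drop_letters: "dom (drop_letters n) = {u. n \<le> length u}"
  by (auto simp: drop_letters_def dom_def)

lemma fg_ri_hom_drop_letters: "fg_ri_hom (drop_letters n :: 'a::finite list \<rightharpoonup> 'a list)"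
proof -
  have "\<forall>x\<in>dom (drop_letters n). take n x \<in> dom (drop_letters n :: 'a list \<rightharpoonup> 'a list)"
    by (simp add: dom_drop_letters)
  moreover have "ri_hom (drop_letters n :: 'a list \<rightharpoonup> 'a list)"
    unfolding ri_hom_iff by (auto simp: drop_letters_def)
  ultimately show ?thesis unfolding fg_ri_hom_iff by blast
qed

lemma essential_dom_drop_letters:
  "essential (dom (drop_letters n :: 'a list \<rightharpoonup> 'a list))"
  unfolding essential_iff
proof (intro conjI allI)
  show "right_ideal (dom (drop_letters n :: 'a list \<rightharpoonup> 'a list))"
    by (simp add: right_ideal_def dom_drop_letters)
  show "\<exists>w. x @ w \<in> dom (drop_letters n)" for x :: "'a list"
    by (rule exI[of _ "replicate n undefined"]) (simp add: dom_drop_letters)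
qed

lemma inj_on_dom_comp:
  assumes "inj_on f (dom f)" "inj_on g (dom g)"
  shows "inj_on (f \<circ>\<^sub>m g) (dom (f \<circ>\<^sub>m g))"
proof (rule inj_onI)
  fix a b assume "a \<in> dom (f \<circ>\<^sub>m g)" "b \<in> dom (f \<circ>\<^sub>m g)" and eq: "(f \<circ>\<^sub>m g) a = (f \<circ>\<^sub>m g) b"
  then obtain c d c' d' where "g a = Some c" "f c = Some c'" "g b = Some d" "f d = Some d'"
    by (auto simp: map_comp_Some_iff)
  hence c: "g a = Some c" "c \<in> dom f" and d: "g b = Some d" "d \<in> dom f" by auto
  hence "f c = f d" using eq by simp
  hence "c = d" using inj_onD[OF assms(1)] c d by blast
  hence "g a = g b" "a \<in> dom g" "b \<in> dom g" using c d by auto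
  thus "a = b" using inj_onD[OF assms(2)] by blast
qed

lemma essential_dom_comp:
  assumes f: "ri_hom f" "essential (dom f)" and g: "ri_hom g" "essential (dom g)"
  shows "essential (dom (f \<circ>\<^sub>m g))"
  unfolding essential_iff
proof (intro conjI allI)
  show "right_ideal (dom (f \<circ>\<^sub>m g))" using right_ideal_dom ri_hom_comp f g by blast
  fix x
  obtain v y where "g (x @ v) = Some y" using g unfolding essential_iff by blast
  moreover obtain w where "y @ w \<in> dom f" using f unfolding essential_iff by blast
  ultimately have "x @ (v @ w) \<in> dom (f \<circ>\<^sub>m g)"
    using ri_hom_append[OF g(1), of "x @ v" y w] by (auto simp: map_comp_def)
  thus "\<exists>w. x @ w \<in> dom (f \<circ>\<^sub>m g)" by blast
qed

lemma M_k1_eq: "M_k1 = max_monoid fg_ri_hom"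
  by (simp add: max_monoid_def M_k1_def)

lemma Inv_k1_eq: "Inv_k1 = max_monoid (\<lambda>f. fg_ri_hom f \<and> inj_on f (dom f))"
  by (simp add: max_monoid_def Inv_k1_def)

lemma tot_M_k1_eq: "tot_M_k1 = max_monoid (\<lambda>f. fg_ri_hom f \<and> essential (dom f))"
  by (simp add: max_monoid_def tot_M_k1_def)

lemma composition_closed_fg_ri_hom:
  "composition_closed (fg_ri_hom :: ('a::finite list \<rightharpoonup> 'a list) \<Rightarrow> bool)"
  unfolding composition_closed_def
proof (intro conjI allI impI)
  show "ri_hom f" if "fg_ri_hom f" for f :: "'a list \<rightharpoonup> 'a list"
    using that unfolding fg_ri_hom_def by blast
  show "fg_ri_hom (Some :: 'a list \<rightharpoonup> 'a list)" by (rule fg_ri_hom_Some)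
  show "fg_ri_hom (f \<circ>\<^sub>m g)" if "fg_ri_hom f" "fg_ri_hom g" for f g :: "'a list \<rightharpoonup> 'a list"
    using that by (rule fg_ri_hom_comp)
qed

lemma zero_J_simple_M_k1: "zero_J_simple (M_k1 :: ('a::finite list \<rightharpoonup> 'a list) monoid)"
  unfolding M_k1_eq
proof (rule zero_J_simple_max_monoid)
  show "composition_closed (fg_ri_hom :: ('a list \<rightharpoonup> 'a list) \<Rightarrow> bool)"
    by (rule composition_closed_fg_ri_hom)
  show "fg_ri_hom (Map.empty :: 'a list \<rightharpoonup> 'a list)" by (rule fg_ri_hom_empty)
  show "fg_ri_hom (\<lambda>w. Some (x @ w))" for x :: "'a list" by (rule fg_ri_hom_insert)
  show "\<exists>p. fg_ri_hom p \<and> (\<forall>w. p (y @ w) = Some w)" for y :: "'a list"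
    by (rule exI[of _ "remove_prefix y"])
      (simp add: fg_ri_hom_remove_prefix remove_prefix_eq_Some_iff)
qed

lemma zero_J_simple_Inv_k1: "zero_J_simple (Inv_k1 :: ('a::finite list \<rightharpoonup> 'a list) monoid)"
  unfolding Inv_k1_eq
proof (rule zero_J_simple_max_monoid)
  show "composition_closed (\<lambda>f :: 'a list \<rightharpoonup> 'a list. fg_ri_hom f \<and> inj_on f (dom f))"
    by (rule composition_closed_conj[OF composition_closed_fg_ri_hom])
      (simp, rule inj_on_dom_comp)
  show "fg_ri_hom (Map.empty :: 'a list \<rightharpoonup> 'a list) \<and> inj_on Map.empty (dom Map.empty)"
    by (simp add: fg_ri_hom_empty)
  show "fg_ri_hom (\<lambda>w. Some (x @ w)) \<and> inj_on (\<lambda>w. Some (x @ w)) (dom (\<lambda>w. Some (x @ w)))"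
    for x :: "'a list"
    by (simp add: fg_ri_hom_insert inj_on_def)
  show "\<exists>p. (fg_ri_hom p \<and> inj_on p (dom p)) \<and> (\<forall>w. p (y @ w) = Some w)" for y :: "'a list"
    by (rule exI[of _ "remove_prefix y"])
      (simp add: fg_ri_hom_remove_prefix inj_on_remove_prefix remove_prefix_eq_Some_iff)
qed

lemma J_simple_tot_M_k1: "J_simple (tot_M_k1 :: ('a::finite list \<rightharpoonup> 'a list) monoid)"
proof -
  let ?P = "\<lambda>f :: 'a list \<rightharpoonup> 'a list. fg_ri_hom f \<and> essential (dom f)"
  have U: "essential (UNIV :: 'a list set)"
    unfolding essential_iff right_ideal_def by blast
  have P: "composition_closed ?P"
  proof (rule composition_closed_conj[OF composition_closed_fg_ri_hom])
    show "essential (dom (Some :: 'a list \<rightharpoonup> 'a list))" using U by (simp add: dom_def)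
    show "essential (dom (f \<circ>\<^sub>m g))"
      if "fg_ri_hom f" "fg_ri_hom g" "essential (dom f)" "essential (dom g)"
      for f g :: "'a list \<rightharpoonup> 'a list"
      using that essential_dom_comp unfolding fg_ri_hom_def by blast
  qed
  have ins: "?P (\<lambda>w. Some (x @ w))" for x
    using fg_ri_hom_insert U by (simp add: dom_def)
  have del: "\<exists>p. ?P p \<and> (\<forall>w. p (y @ w) = Some w)" for y
  proof (intro exI conjI allI)
    show "fg_ri_hom (drop_letters (length y) :: 'a list \<rightharpoonup> 'a list)"
      by (rule fg_ri_hom_drop_letters)
    show "essential (dom (drop_letters (length y) :: 'a list \<rightharpoonup> 'a list))"
      by (rule essential_dom_drop_letters)
    show "drop_letters (length y) (y @ w) = Some w" for w
      by (simp add: drop_letters_def)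
  qed
  have nonempty: "F \<noteq> Map.empty" if F: "F \<in> carrier (max_monoid ?P)" for F
  proof -
    obtain f where f: "?P f" "F = max_ext f" using F by auto
    obtain x where "x \<in> dom f" using f unfolding essential_iff by blast
    moreover have "f \<subseteq>\<^sub>m F"
      using f ess_ext_max_ext unfolding fg_ri_hom_def ess_ext_iff by blast
    ultimately have "x \<in> dom F" using map_le_implies_dom_le by blast
    thus ?thesis by auto
  qed
  show ?thesis
    unfolding tot_M_k1_eq
    by (rule J_simpleI[OF monoid_max_monoid[OF P] one_eq_product[OF P ins del _ nonempty]])
qed

theorem proposition2p2:
  assumes "2 \<le> CARD('a::finite)"
  shows "zero_J_simple (Inv_k1 :: ('a list \<rightharpoonup> 'a list) monoid) \<and>
         zero_J_simple (M_k1 :: ('a list \<rightharpoonup> 'a list) monoid) \<and>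
         J_simple (tot_M_k1 :: ('a list \<rightharpoonup> 'a list) monoid)"
  using zero_J_simple_Inv_k1 zero_J_simple_M_k1 J_simple_tot_M_k1 by blast

end
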